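(* Let $J$ be a symmetric subgraph of $K_{n,n}$. Then $\chi_\infty(K_n,J)$ is finite if and only if there are no $i\neq j$ in $\{1,\dots,n\}$ such that $J$ contains all three edges $(i,i')$, $(i,j')$, $(j,i')$.
   Context: Let $G=K_n$ be the complete graph with vertex set $\{v_1,\dots,v_n\}$. Let $K_{n,n}$ be the complete bipartite graph with parts $I_n=\{1,\dots,n\}$ and $I_n'=\{1',\dots,n'\}$; a subgraph $J$ of $K_{n,n}$ with vertex set $I_n\cup I_n'$ is symmetric if $i\sim j'$ iff $j\sim i'$. The self-similar graphs based on $(G,J)$: $G^1=G$; for $k\ge2$, $V(G^k)=V(G)^k$, and $(v_{i_1},\dots,v_{i_k})\sim(v_{j_1},\dots,v_{j_k})$ in $G^k$ iff either (1) $(v_{i_1},\dots,v_{i_{k-1}})=(v_{j_1},\dots,v_{j_{k-1}})$ and $v_{i_k}\sim v_{j_k}$ in $G$, or (2) $(v_{i_1},\dots,v_{i_{k-1}})\sim(v_{j_1},\dots,v_{j_{k-1}})$ in $G^{k-1}$ and $i_k\sim j_k'$ in $J$. The sequence $\chi(G^k)$ is non-decreasing; $\chi_\infty(G,J)$ denotes its limit, with $\chi_\infty(G,J)=\infty$ if it is unbounded. *)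

theory Defs
  imports "HOL-Library.Extended_Real"
begin

datatype 'a graph = Graph (verts: "'a set") (edges: "'a set set")

definition simple_graph :: "'a graph \<Rightarrow> bool" where
  "simple_graph G \<longleftrightarrow>
     (\<forall>e\<in>edges G. \<exists>u\<in>verts G. \<exists>v\<in>verts G. u \<noteq> v \<and> e = {u, v})"

definition adj :: "'a graph \<Rightarrow> 'a \<Rightarrow> 'a \<Rightarrow> bool" where
  "adj G u v \<longleftrightarrow> {u, v} \<in> edges G"

definition subgraph :: "'a graph \<Rightarrow> 'a graph \<Rightarrow> bool" where
  "subgraph H G \<longleftrightarrow> simple_graph H \<and> verts H \<subseteq> verts G \<and> edges H \<subseteq> edges G"

text \<open>The vertex \<open>v\<^sub>i\<close> of \<open>K\<^sub>n\<close> is identified with its index \<open>i\<close>.\<close>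

definition complete_graph :: "nat \<Rightarrow> nat graph" where
  "complete_graph n = Graph {1..n} {{u, v} | u v. u \<in> {1..n} \<and> v \<in> {1..n} \<and> u \<noteq> v}"

text \<open>In \<open>K\<^sub>n\<^sub>,\<^sub>n\<close> the vertex \<open>i\<close> of the first part is \<open>Inl i\<close>
  and the vertex \<open>j'\<close> of the second part is \<open>Inr j\<close>.\<close>

definition complete_bipartite :: "nat \<Rightarrow> (nat + nat) graph" where
  "complete_bipartite n =
     Graph (Inl ` {1..n} \<union> Inr ` {1..n})
       {{Inl i, Inr j} | i j. i \<in> {1..n} \<and> j \<in> {1..n}}"

definition symmetric_subgraph :: "nat \<Rightarrow> (nat + nat) graph \<Rightarrow> bool" where
  "symmetric_subgraph n J \<longleftrightarrow>
     subgraph J (complete_bipartite n) \<and>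
     verts J = Inl ` {1..n} \<union> Inr ` {1..n} \<and>
     (\<forall>i\<in>{1..n}. \<forall>j\<in>{1..n}. adj J (Inl i) (Inr j) \<longleftrightarrow> adj J (Inl j) (Inr i))"

text \<open>\<open>self_similar G J k\<close> is \<open>G\<^sup>k\<close>; a \<open>k\<close>-tuple of vertices is a list of length \<open>k\<close>.
  The construction starts at \<open>k = 1\<close>; the value at \<open>k = 0\<close> is a dummy.\<close>

fun self_similar :: "nat graph \<Rightarrow> (nat + nat) graph \<Rightarrow> nat \<Rightarrow> nat list graph" where
  "self_similar G J 0 = Graph {[]} {}"
| "self_similar G J (Suc 0) =
     Graph {[i] | i. i \<in> verts G} {{[i], [j]} | i j. i \<in> verts G \<and> j \<in> verts G \<and> adj G i j}"
| "self_similar G J (Suc (Suc k)) =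
     (let H = self_similar G J (Suc k) in
      Graph {xs @ [i] | xs i. xs \<in> verts H \<and> i \<in> verts G}
        {{xs @ [i], ys @ [j]} | xs i ys j.
           xs \<in> verts H \<and> ys \<in> verts H \<and> i \<in> verts G \<and> j \<in> verts G \<and>
           (xs = ys \<and> adj G i j \<or> adj H xs ys \<and> adj J (Inl i) (Inr j))})"

definition proper_colouring :: "'a graph \<Rightarrow> nat \<Rightarrow> ('a \<Rightarrow> nat) \<Rightarrow> bool" where
  "proper_colouring G m c \<longleftrightarrow>
     (\<forall>v\<in>verts G. c v < m) \<and>
     (\<forall>u\<in>verts G. \<forall>v\<in>verts G. adj G u v \<longrightarrow> c u \<noteq> c v)"

text \<open>Meaningful for finite loopless graphs only, for which a proper colouring exists.\<close>

definition chromatic_number :: "'a graph \<Rightarrow> nat" where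
  "chromatic_number G = (LEAST m. \<exists>c. proper_colouring G m c)"

text \<open>The limit is taken in the extended naturals. It exists for nonempty \<open>G\<close>:
  prefixing all tuples with a fixed vertex embeds \<open>G\<^sup>k\<close> into \<open>G\<^sup>k\<^sup>+\<^sup>1\<close>,
  so the sequence is non-decreasing.\<close>

definition chi_infinity :: "nat graph \<Rightarrow> (nat + nat) graph \<Rightarrow> enat" where
  "chi_infinity G J = lim (\<lambda>k. enat (chromatic_number (self_similar G J k)))"

end

theory Submission
  imports Defs
begin

text \<open>
  Two distinct tuples are adjacent in \<open>G\<^sup>k\<close> iff the entries after their first
  difference are related by \<open>J\<close>, position by position. If \<open>J\<close> contains
  \<open>(i,i')\<close>, \<open>(i,j')\<close>, \<open>(j,i')\<close>, then the \<open>k\<close> tuples with a single entry \<open>j\<close> and all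
  others \<open>i\<close> form a clique. Otherwise an index \<open>i\<close> with \<open>(i,i')\<close> in \<open>J\<close> is related to
  itself only. For adjacent tuples, either an index without a loop occurs after the first
  difference, and then the last loopless entries of the two tuples differ; or the tuples
  differ in exactly one entry, and then their sums differ modulo \<open>n\<close>. So the pair (last
  loopless entry, sum modulo \<open>n\<close>) is a proper colouring with a number of colours
  independent of \<open>k\<close>.
\<close>

section \<open>Adjacency through the first difference of two tuples\<close>

definition split_adj :: "('a \<Rightarrow> 'a \<Rightarrow> bool) \<Rightarrow> 'a list \<Rightarrow> 'a list \<Rightarrow> bool" where
  "split_adj R xs ys \<longleftrightarrow>
     (\<exists>ps a b us vs. xs = ps @ a # us \<and> ys = ps @ b # vs \<and> a \<noteq> b \<and> list_all2 R us vs)"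

text \<open>These are the two clauses of \<open>self_similar\<close> for a complete graph, where
  adjacency is distinctness. Which clause applies depends on whether the first difference is at the
  last position, that is, whether \<open>us\<close> is empty.\<close>

lemma split_adj_snoc:
  "split_adj R (xs @ [i]) (ys @ [j]) \<longleftrightarrow> xs = ys \<and> i \<noteq> j \<or> split_adj R xs ys \<and> R i j"
proof
  assume "split_adj R (xs @ [i]) (ys @ [j])"
  then obtain ps a b us vs where
    *: "xs @ [i] = ps @ a # us" "ys @ [j] = ps @ b # vs" "a \<noteq> b" "list_all2 R us vs"
    unfolding split_adj_def by blast
  show "xs = ys \<and> i \<noteq> j \<or> split_adj R xs ys \<and> R i j"
  proof (cases us rule: rev_cases)
    case Nil
    then show ?thesis using * by auto
  next
    case (snoc us' u)
    then obtain vs' v where vs: "vs = vs' @ [v]" "list_all2 R us' vs'" "R u v"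
      using *(4) by (auto simp: list_all2_append1 list_all2_Cons1)
    have "xs = ps @ a # us'" "i = u"
      using *(1) snoc by (simp_all flip: append_Cons append_assoc)
    moreover have "ys = ps @ b # vs'" "j = v"
      using *(2) vs(1) by (simp_all flip: append_Cons append_assoc)
    ultimately show ?thesis
      using *(3) vs unfolding split_adj_def by blast
  qed
next
  assume "xs = ys \<and> i \<noteq> j \<or> split_adj R xs ys \<and> R i j"
  then show "split_adj R (xs @ [i]) (ys @ [j])"
  proof
    assume "xs = ys \<and> i \<noteq> j"
    then show ?thesis unfolding split_adj_def by blast
  next
    assume "split_adj R xs ys \<and> R i j"
    then obtain ps a b us vs where
      *: "xs = ps @ a # us" "ys = ps @ b # vs" "a \<noteq> b" "list_all2 R us vs" and "R i j"
      unfolding split_adj_def by blast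
    have "xs @ [i] = ps @ a # (us @ [i])" "ys @ [j] = ps @ b # (vs @ [j])"
      using * by simp_all
    moreover have "list_all2 R (us @ [i]) (vs @ [j])"
      using * \<open>R i j\<close> by (simp add: list_all2_appendI)
    ultimately show ?thesis
      using *(3) unfolding split_adj_def by blast
  qed
qed

lemma split_adj_Cons: "split_adj R xs ys \<Longrightarrow> split_adj R (a # xs) (a # ys)"
  unfolding split_adj_def by (metis append_Cons)

lemma split_adj_neq: "split_adj R xs ys \<Longrightarrow> xs \<noteq> ys"
  unfolding split_adj_def by auto

lemma split_adj_sym:
  assumes "symp R" "split_adj R xs ys"
  shows "split_adj R ys xs"
proof -
  obtain ps a b us vs where
    *: "xs = ps @ a # us" "ys = ps @ b # vs" "a \<noteq> b" "list_all2 R us vs"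
    using assms(2) unfolding split_adj_def by blast
  have "list_all2 R vs us"
    using list_all2_conv_all_nth[of R] *(4) assms(1) by (simp add: sympD)
  then show ?thesis
    using * unfolding split_adj_def by metis
qed

section \<open>Chromatic number of finite loopless graphs\<close>

lemma chromatic_number_le: "proper_colouring G m c \<Longrightarrow> chromatic_number G \<le> m"
  unfolding chromatic_number_def by (rule Least_le) blast

text \<open>Giving every vertex its own colour works. This makes the \<open>LEAST\<close> in
  \<open>chromatic_number\<close> range over a nonempty set, so that the minimum is
  attained.\<close>

lemma finite_proper_colouring:
  assumes "finite (verts G)" "\<And>v. v \<in> verts G \<Longrightarrow> \<not> adj G v v"
  obtains c where "proper_colouring G (card (verts G)) c"
proof -
  obtain c where "bij_betw c (verts G) {0..<card (verts G)}"
    using ex_bij_betw_finite_nat[OF assms(1)] by blast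
  then have "proper_colouring G (card (verts G)) c"
    using assms(2) unfolding proper_colouring_def bij_betw_def inj_on_def
    by (metis atLeastLessThan_iff image_eqI)
  then show ?thesis by (rule that)
qed

lemma chromatic_number_colouring:
  assumes "finite (verts G)" "\<And>v. v \<in> verts G \<Longrightarrow> \<not> adj G v v"
  obtains c where "proper_colouring G (chromatic_number G) c"
proof -
  have "\<exists>m c. proper_colouring G m c"
    using finite_proper_colouring[OF assms] by metis
  then have "\<exists>c. proper_colouring G (chromatic_number G) c"
    unfolding chromatic_number_def by (rule LeastI_ex)
  then show ?thesis using that by blast
qed

lemma verts_complete_graph: "verts (complete_graph n) = {1..n}"
  by (simp add: complete_graph_def)

lemma adj_complete_graph:
  "adj (complete_graph n) i j \<longleftrightarrow> i \<in> {1..n} \<and> j \<in> {1..n} \<and> i \<noteq> j"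
  unfolding adj_def complete_graph_def by (auto simp: doubleton_eq_iff)

section \<open>The powers of the complete graph and the limit of their chromatic numbers\<close>

context
  fixes n :: nat and J :: "(nat + nat) graph"
  assumes n: "n \<ge> 1" and J: "symmetric_subgraph n J"
begin

abbreviation rel :: "nat \<Rightarrow> nat \<Rightarrow> bool" where
  "rel i j \<equiv> adj J (Inl i) (Inr j)"

abbreviation G :: "nat \<Rightarrow> nat list graph" where
  "G \<equiv> self_similar (complete_graph n) J"

lemma rel_range: "rel i j \<Longrightarrow> i \<in> {1..n} \<and> j \<in> {1..n}"
  using J unfolding symmetric_subgraph_def subgraph_def complete_bipartite_def adj_def
  by (auto simp: doubleton_eq_iff)

lemma symp_rel: "symp rel"
  using J rel_range unfolding symmetric_subgraph_def symp_def by blast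

lemma verts_G: "verts (G k) = {xs. length xs = k \<and> set xs \<subseteq> {1..n}}"
proof (induction "complete_graph n" J k rule: self_similar.induct)
  case 1
  then show ?case by auto
next
  case 2
  then show ?case by (auto simp: complete_graph_def length_Suc_conv)
next
  case (3 J k)
  have "verts (self_similar (complete_graph n) J (Suc (Suc k))) =
      {xs @ [i] | xs i. length xs = Suc k \<and> set xs \<subseteq> {1..n} \<and> i \<in> {1..n}}"
    using 3 by (simp add: Let_def verts_complete_graph)
  also have "\<dots> = {xs. length xs = Suc (Suc k) \<and> set xs \<subseteq> {1..n}}"
  proof (intro set_eqI iffI)
    fix xs assume "xs \<in> {xs. length xs = Suc (Suc k) \<and> set xs \<subseteq> {1..n}}"
    then show "xs \<in> {xs @ [i] | xs i. length xs = Suc k \<and> set xs \<subseteq> {1..n} \<and> i \<in> {1..n}}"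
      by (cases xs rule: rev_cases) auto
  qed auto
  finally show ?case .
qed

lemma adj_G:
  "adj (G k) xs ys \<longleftrightarrow> xs \<in> verts (G k) \<and> ys \<in> verts (G k) \<and> split_adj rel xs ys"
proof (induction k arbitrary: xs ys)
  case 0
  then show ?case by (auto simp: adj_def split_adj_def)
next
  case (Suc k)
  show ?case
  \<comment> \<open>\<open>self_similar\<close> has a separate equation for exponent 1, which does
    not refer to the dummy value at 0.\<close>
  proof (cases k)
    case 0
    have "split_adj rel [i] [j] \<longleftrightarrow> i \<noteq> j" for i j
      using split_adj_snoc[of rel "[]" i "[]" j] by (auto simp: split_adj_def)
    then show ?thesis
      unfolding 0 by (auto simp: adj_def[of "Graph _ _"] doubleton_eq_iff adj_complete_graph
          verts_complete_graph, metis+)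
  next
    case (Suc m)
    define V where "V = verts (G k)"
    define W where "W = verts (G (Suc k))"
    have W: "W = {xs @ [i] | xs i. xs \<in> V \<and> i \<in> {1..n}}"
      unfolding V_def W_def Suc by (simp add: Let_def verts_complete_graph)
    have E: "edges (G (Suc k)) =
      {{xs @ [i], ys @ [j]} | xs i ys j. xs \<in> V \<and> ys \<in> V \<and> i \<in> {1..n} \<and> j \<in> {1..n} \<and>
        (xs = ys \<and> adj (complete_graph n) i j \<or> adj (G k) xs ys \<and> rel i j)}"
      unfolding V_def Suc by (simp add: Let_def verts_complete_graph)
    also have "\<dots> = {{xs @ [i], ys @ [j]} | xs i ys j.
        xs \<in> V \<and> ys \<in> V \<and> i \<in> {1..n} \<and> j \<in> {1..n} \<and> split_adj rel (xs @ [i]) (ys @ [j])}"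
      unfolding split_adj_snoc Suc.IH adj_complete_graph V_def by blast
    also have "\<dots> = {{xs, ys} | xs ys. xs \<in> W \<and> ys \<in> W \<and> split_adj rel xs ys}"
      unfolding W by blast
    finally have "adj (G (Suc k)) xs ys \<longleftrightarrow>
        (\<exists>xs' ys'. {xs, ys} = {xs', ys'} \<and> xs' \<in> W \<and> ys' \<in> W \<and> split_adj rel xs' ys')"
      unfolding adj_def by blast
    \<comment> \<open>Edges are unordered pairs, so the two tuples may come out swapped; the
      symmetry of \<open>J\<close> repairs this.\<close>
    also have "\<dots> \<longleftrightarrow> xs \<in> W \<and> ys \<in> W \<and> split_adj rel xs ys"
      using split_adj_sym[OF symp_rel] unfolding doubleton_eq_iff by blast
    finally show ?thesis unfolding W_def .
  qed
qed

lemma colouring_G: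
  obtains c where "proper_colouring (G k) (chromatic_number (G k)) c"
proof (rule chromatic_number_colouring)
  show "finite (verts (G k))"
    using finite_lists_length_eq[of "{1..n}" k] unfolding verts_G by (simp add: conj_commute)
  show "\<not> adj (G k) v v" for v
    unfolding adj_G using split_adj_neq by blast
qed (rule that)

text \<open>A common first entry leaves everything from the first difference on unchanged, so
  prepending 1, a vertex since \<open>n \<ge> 1\<close>, preserves adjacency. A colouring of the
  larger power then pulls back to the smaller one.\<close>

lemma incseq_chromatic_number: "incseq (\<lambda>k. chromatic_number (G k))"
proof (rule incseq_SucI)
  fix k
  obtain c where c: "proper_colouring (G (Suc k)) (chromatic_number (G (Suc k))) c"
    by (rule colouring_G)
  have V: "1 # xs \<in> verts (G (Suc k))" if "xs \<in> verts (G k)" for xs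
    using that n unfolding verts_G by auto
  have "adj (G (Suc k)) (1 # xs) (1 # ys)" if "adj (G k) xs ys" for xs ys
    using that V by (simp add: adj_G split_adj_Cons)
  then have "proper_colouring (G k) (chromatic_number (G (Suc k))) (\<lambda>xs. c (1 # xs))"
    using c V unfolding proper_colouring_def by simp
  then show "chromatic_number (G k) \<le> chromatic_number (G (Suc k))"
    by (rule chromatic_number_le)
qed

text \<open>Monotone sequences of extended naturals converge to their supremum. Finiteness of the
  limit thus becomes boundedness of the chromatic numbers.\<close>

lemma chi_infinity_eq_SUP:
  "chi_infinity (complete_graph n) J = (SUP k. enat (chromatic_number (G k)))"
proof -
  have "incseq (\<lambda>k. enat (chromatic_number (G k)))"
    using incseq_chromatic_number by (simp add: incseq_def)
  then show ?thesis
    unfolding chi_infinity_def by (intro limI LIMSEQ_SUP)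
qed

section \<open>Lower bound from a clique of size \<open>k\<close>\<close>

lemma chromatic_number_ge:
  assumes "i \<noteq> j" "rel i i" "rel i j"
  shows "k \<le> chromatic_number (G k)"
proof -
  have ij: "i \<in> {1..n}" "j \<in> {1..n}"
    using rel_range assms(3) by auto
  define e where "e p = replicate p i @ j # replicate (k - Suc p) i" for p
  have V: "e p \<in> verts (G k)" if "p < k" for p
    using ij that unfolding verts_G e_def by (auto simp: set_replicate_conv_if)
  \<comment> \<open>The first difference is at position \<open>p\<close>. After it
    \<open>e p\<close> is constantly \<open>i\<close>, while \<open>e q\<close> has \<open>j\<close>
    at position \<open>q\<close> and \<open>i\<close> elsewhere, so only \<open>rel i i\<close> and
    \<open>rel i j\<close> occur.\<close>
  have adj: "adj (G k) (e p) (e q)" if "p < q" "q < k" for p q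
  proof -
    define r where "r = replicate (q - Suc p) i @ j # replicate (k - Suc q) i"
    have "replicate q i = replicate p i @ i # replicate (q - Suc p) i"
      using that by (metis add_diff_inverse_nat not_less_iff_gr_or_eq
          replicate_Suc replicate_add Suc_diff_Suc)
    then have "e q = replicate p i @ i # r"
      unfolding e_def r_def by simp
    moreover have "list_all2 rel (replicate (k - Suc p) i) r"
      using that assms unfolding r_def list_all2_conv_all_nth
      by (auto simp: nth_append nth_Cons split: nat.split)
    ultimately have "split_adj rel (e p) (e q)"
      using \<open>i \<noteq> j\<close> unfolding split_adj_def e_def[of p] by metis
    then show ?thesis
      using V that unfolding adj_G by auto
  qed
  obtain c where c: "proper_colouring (G k) (chromatic_number (G k)) c"
    by (rule colouring_G)
  have "inj_on (c \<circ> e) {..<k}"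
  proof (rule linorder_inj_onI)
    fix p q assume "p < q" "p \<in> {..<k}" "q \<in> {..<k}"
    then show "(c \<circ> e) p \<noteq> (c \<circ> e) q"
      using adj[of p q] V c unfolding proper_colouring_def by auto
  qed auto
  moreover have "(c \<circ> e) ` {..<k} \<subseteq> {..<chromatic_number (G k)}"
    using V c unfolding proper_colouring_def by auto
  ultimately show ?thesis
    using card_inj_on_le[of "c \<circ> e" "{..<k}" "{..<chromatic_number (G k)}"] by simp
qed

section \<open>Upper bound from an explicit colouring\<close>

lemma chromatic_number_bounded:
  assumes iso: "\<And>i j. rel i i \<Longrightarrow> rel i j \<Longrightarrow> i = j"
  shows "chromatic_number (G k) \<le> Suc n * n"
proof (rule chromatic_number_le)
  define loopless where "loopless = filter (\<lambda>i. \<not> rel i i)"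
  \<comment> \<open>The prepended 0 is the default when no entry is loopless. Hence \<open>l\<close>
    takes at most \<open>Suc n\<close> values, and \<open>c\<close> packs it with a residue as a
    quotient and remainder modulo \<open>n\<close>.\<close>
  define l where "l xs = last (0 # loopless xs)" for xs
  define c where "c xs = l xs * n + sum_list xs mod n" for xs
  have "c xs < Suc n * n" if "set xs \<subseteq> {1..n}" for xs
  proof -
    have "set (0 # loopless xs) \<subseteq> {..n}"
      using that unfolding loopless_def by auto
    then have "l xs \<le> n"
      unfolding l_def by (metis atMost_iff last_in_set list.distinct(1) subsetD)
    then have "l xs * n \<le> n * n" by simp
    moreover have "sum_list xs mod n < n" using n by simp
    ultimately have "l xs * n + sum_list xs mod n < n * n + n"
      by (rule add_le_less_mono)
    then show ?thesis unfolding c_def by simp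
  qed
  moreover have "c xs \<noteq> c ys"
    if adj: "split_adj rel xs ys" and range: "set xs \<subseteq> {1..n}" "set ys \<subseteq> {1..n}" for xs ys
  proof
    assume "c xs = c ys"
    moreover have "c zs div n = l zs" "c zs mod n = sum_list zs mod n" for zs
      using n unfolding c_def by simp_all
    ultimately have eq: "l xs = l ys" "sum_list xs mod n = sum_list ys mod n"
      by metis+
    obtain ps a b us vs where
      *: "xs = ps @ a # us" "ys = ps @ b # vs" "a \<noteq> b" "list_all2 rel us vs"
      using adj unfolding split_adj_def by blast
    \<comment> \<open>Related indices are both looped or both loopless, so dropping the looped ones
      keeps \<open>us\<close> and \<open>vs\<close> aligned.\<close>
    have loop: "rel i i \<longleftrightarrow> rel j j" if "rel i j" for i j
      using that iso symp_rel by (metis sympD)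
    have L: "list_all2 rel (loopless us) (loopless vs)"
      using *(4) unfolding loopless_def
      by (induction rule: list_all2_induct) (use loop in auto)
    show False
    proof (cases "loopless us = []")
      case True
      have "us = vs"
        using *(4) True unfolding loopless_def
        by (induction rule: list_all2_induct) (use iso in \<open>auto split: if_splits\<close>)
      define s where "s = sum_list ps + sum_list us"
      have "(s + a) mod n = (s + b) mod n"
        using eq(2) unfolding * \<open>us = vs\<close> s_def by (simp add: ac_simps)
      \<comment> \<open>Both entries lie between 1 and \<open>n\<close>, so their distance is below
        \<open>n\<close> and the congruence forces them to be equal.\<close>
      then have "int n dvd int a - int b"
        by (metis add_diff_cancel_left mod_eq_dvd_iff of_nat_add of_nat_mod)
      moreover have "\<bar>int a - int b\<bar> < int n"
        using range unfolding * by auto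
      ultimately show False
        using dvd_imp_le_int[of "int a - int b" "int n"] \<open>a \<noteq> b\<close> by simp
    next
      case False
      then have ne: "loopless vs \<noteq> []" using L by auto
      have "l xs = last (loopless us)" "l ys = last (loopless vs)"
        using False ne unfolding l_def * loopless_def by auto
      \<comment> \<open>Were these two last entries equal, the relation between them would be a loop
        at a loopless index.\<close>
      moreover have "rel (last (loopless us)) (last (loopless vs))"
        using L False by (induction rule: list_all2_induct) auto
      moreover have "last (loopless us) \<in> set (loopless us)"
        using False by simp
      then have "\<not> rel (last (loopless us)) (last (loopless us))"
        unfolding loopless_def by simp
      ultimately show False using eq(1) by simp
    qed
  qed
  ultimately show "proper_colouring (G k) (Suc n * n) c"
    unfolding proper_colouring_def adj_G verts_G by blast
qed

end

theorem theorem3p6: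
  fixes n :: nat and J :: "(nat + nat) graph"
  assumes "n \<ge> 1"
    and "symmetric_subgraph n J"
  shows "chi_infinity (complete_graph n) J \<noteq> \<infinity> \<longleftrightarrow>
    \<not> (\<exists>i\<in>{1..n}. \<exists>j\<in>{1..n}. i \<noteq> j \<and>
         adj J (Inl i) (Inr i) \<and> adj J (Inl i) (Inr j) \<and> adj J (Inl j) (Inr i))"
    (is "_ \<longleftrightarrow> \<not> ?bad")
proof (cases ?bad)
  case True
  then have *: "k \<le> chromatic_number (self_similar (complete_graph n) J k)" for k
    using chromatic_number_ge[OF assms] by blast
  have "enat k \<le> chi_infinity (complete_graph n) J" for k
    unfolding chi_infinity_eq_SUP[OF assms] by (rule SUP_upper2[of k]) (use * in auto)
  then have "chi_infinity (complete_graph n) J = \<infinity>"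
    by (metis Suc_ile_eq enat.exhaust order_less_irrefl)
  then show ?thesis using True by simp
next
  case False
  \<comment> \<open>By symmetry of \<open>J\<close> the third edge of the forbidden pattern comes
    with the second.\<close>
  have "i = j" if "adj J (Inl i) (Inr i)" "adj J (Inl i) (Inr j)" for i j
    using that False rel_range[OF assms] symp_rel[OF assms] by (metis sympD)
  then have "chi_infinity (complete_graph n) J \<le> enat (Suc n * n)"
    unfolding chi_infinity_eq_SUP[OF assms]
    by (intro SUP_least) (use chromatic_number_bounded[OF assms] in simp)
  then have "chi_infinity (complete_graph n) J \<noteq> \<infinity>"
    by (metis infinity_ileE)
  then show ?thesis using False by simp
qed

end
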